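(* Let $k \geq 1$ and $n \geq 2$ be two fixed natural numbers. Then the polynomial $$R_{2k+1,n}(z) := \sum_{j=1}^{k} (n^{2j}-1)(n^{2k+2-2j}-1)\frac{B_{2j}\,B_{2k+2-2j}}{(2j)!\,(2k+2-2j)!}(nz)^{2k+2-2j}$$ has only one real root, namely $z=0$, and this root has multiplicity $2$. Moreover, all the non-real (complex) roots of $R_{2k+1,n}(z)$ are simple and lie on the circle $|z| = \frac{1}{n}$.
   Context: $B_m$ denotes the $m$-th Bernoulli number, defined by $\frac{t}{e^t-1} = \sum_{m\ge 0} B_m \frac{t^m}{m!}$. The polynomial $R_{2k+1,n}(z)$ is called a Ramanujan-type polynomial; it is regarded as a polynomial in the complex variable $z$. *)

theory Defs
  imports
    "HOL-Analysis.Analysis"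
    "HOL-Computational_Algebra.Computational_Algebra"
begin

text \<open>
  Bernoulli numbers, read off from the exponential generating function \<open>t / (e\<^sup>t - 1)\<close>.
  The quotient is division of formal power series, which is exact here although \<open>e\<^sup>t - 1\<close> is
  not a unit: the common factor \<open>t\<close> is cancelled (lemma \<open>bernoulli_egf\<close> below).
\<close>

definition bernoulli :: "nat \<Rightarrow> real" where
  "bernoulli m = fact m * fps_nth (fps_X / (fps_exp 1 - 1)) m"

lemma bernoulli_egf:
  "Abs_fps (\<lambda>m. bernoulli m / fact m) * (fps_exp 1 - 1) = fps_X"
proof -
  have nth1: "fps_nth (fps_exp 1 - 1 :: real fps) 1 = 1"
    by simp
  then have nz: "fps_exp 1 - 1 \<noteq> (0 :: real fps)"
    by (metis fps_zero_nth zero_neq_one)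
  have "subdegree (fps_exp 1 - 1 :: real fps) \<le> subdegree (fps_X :: real fps)"
    using subdegree_leI[of "fps_exp 1 - 1 :: real fps" 1] nth1 by simp
  then have "(fps_exp 1 - 1 :: real fps) dvd fps_X"
    using nz by (simp add: fps_dvd_iff)
  moreover have "Abs_fps (\<lambda>m. bernoulli m / fact m) = fps_X / (fps_exp 1 - 1)"
    by (simp add: bernoulli_def fps_eq_iff)
  ultimately show ?thesis
    by simp
qed

text \<open>
  \<open>ramanujan_poly k n\<close> is the polynomial \<open>R\<^bsub>2k+1,n\<^esub>(z)\<close>. The factor \<open>[:0, of_nat n:]\<close>
  is the linear polynomial \<open>n z\<close>; the truncated subtraction in \<open>2 * k + 2 - 2 * j\<close> is
  harmless because \<open>j \<le> k\<close>.
\<close>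

definition ramanujan_poly :: "nat \<Rightarrow> nat \<Rightarrow> complex poly" where
  "ramanujan_poly k n =
     (\<Sum>j=1..k.
        smult (of_real ((real n ^ (2 * j) - 1) * (real n ^ (2 * k + 2 - 2 * j) - 1) *
                 (bernoulli (2 * j) * bernoulli (2 * k + 2 - 2 * j) /
                   (fact (2 * j) * fact (2 * k + 2 - 2 * j)))))
              ([:0, of_nat n:] ^ (2 * k + 2 - 2 * j)))"

end

theory Submission
  imports Defs "HOL-Complex_Analysis.Complex_Analysis"
begin

text \<open>
  By Euler's formula \<open>B\<^bsub>2j\<^esub>/(2j)! = (-1)\<^bsup>j+1\<^esup> 2\<zeta>(2j)/(2\<pi>)\<^bsup>2j\<^esup>\<close>, the coefficients of
  \<open>R\<^bsub>2k+1,n\<^esub>\<close> are, up to a common factor, \<open>f(j) f(k+1-j)\<close> with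
  \<open>f(j) = (1 - n\<^bsup>-2j\<^esup>) \<zeta>(2j) = \<Sum> m\<^bsup>-2j\<^esup>\<close>, the sum over the \<open>m\<close> not divisible by \<open>n\<close>.
  This \<open>f\<close> is strictly log-convex by Cauchy--Schwarz, so the coefficients are palindromic and
  strictly increase from the middle outwards. Writing \<open>Q(w) = w\<^sup>d (A(w) + A(1/w))\<close>, where \<open>A\<close>
  collects the upper half of the coefficients, all roots of \<open>A\<close> lie in the open unit disc
  by the theorem of Enestroem and Kakeya. Hence \<open>|A(1/w)| < |A(w)|\<close> for \<open>|w| > 1\<close>, and
  \<open>Re (w A'(w)/A(w)) > 0\<close> for \<open>|w| = 1\<close>: the former keeps the roots of \<open>Q\<close> on the unit circle, the
  latter makes them simple.
\<close>

section \<open>Euler's formula for the Bernoulli numbers of even index\<close>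

definition zeta_even :: "nat \<Rightarrow> real" where
  "zeta_even j = (\<Sum>k. 1 / real (Suc k) ^ (2 * j))"

lemma summable_zeta_even:
  assumes "j \<ge> 1" shows "summable (\<lambda>k. 1 / real (Suc k) ^ (2 * j))"
proof -
  have "summable (\<lambda>k. 1 / real k ^ (2 * j))"
    using inverse_power_summable[of "2*j", where ?'a=real] assms by (simp add: field_simps)
  thus ?thesis by (subst summable_Suc_iff[of "\<lambda>k. 1 / real k ^ (2 * j)"])
qed

text \<open>
  The coefficients of \<open>ln (sinh (\<pi> u) / (\<pi> u))\<close> as a power series in \<open>w = u\<^sup>2\<close>.
  Division by zero gives the correct value \<open>0\<close> for the constant term.
\<close>
definition log_sine_coeff :: "nat \<Rightarrow> real" where
  "log_sine_coeff j = - ((-1) ^ j) / real j * zeta_even j"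

lemma log_sine_coeff_0 [simp]: "log_sine_coeff 0 = 0"
  by (simp add: log_sine_coeff_def)

text \<open>Expanding the logarithm of each factor in powers of \<open>w\<close> turns the partial
  product into \<open>exp\<close> of a series whose coefficients are truncated zeta sums. Tannery's
  theorem then allows the limit to be taken termwise.\<close>

lemma product_tendsto_exp_log_sine:
  fixes w :: complex
  assumes w: "norm w < 1"
  shows "summable (\<lambda>j. complex_of_real (log_sine_coeff j) * w ^ j)" (is ?A)
    and "(\<lambda>n. \<Prod>k=1..n. 1 + w / of_nat k ^ 2) \<longlonglongrightarrow>
           exp (\<Sum>j. of_real (log_sine_coeff j) * w ^ j)" (is ?B)
proof -
  define p where "p n j = (\<Sum>k<n. 1 / real (Suc k) ^ (2 * j))" for n j
  define a where "a j n = complex_of_real (- ((-1) ^ j) / real j * p n j) * w ^ j" for j n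
  \<comment> \<open>For \<open>j \<ge> 1\<close> every \<open>p n j\<close> is at most
    \<open>zeta_even 1\<close>, and the term for \<open>j = 0\<close> vanishes, so this geometric
    majorant holds uniformly in \<open>n\<close>.\<close>
  define M where "M j = norm w ^ j * zeta_even 1" for j
  have p0: "p n j \<ge> 0" for n j unfolding p_def by (intro sum_nonneg) simp
  have p_le: "p n j \<le> zeta_even 1" if "j \<ge> 1" for n j
  proof -
    have "p n j \<le> p n 1" unfolding p_def
      using that by (intro sum_mono divide_left_mono power_increasing) auto
    also have "\<dots> \<le> zeta_even 1" unfolding p_def zeta_even_def
      by (intro sum_le_suminf summable_zeta_even) auto
    finally show ?thesis .
  qed
  have bound: "norm (a j n) \<le> M j" for j n
  proof (cases "j = 0")
    case True
    thus ?thesis using p0[of 0 1] p_le[of 1 0] by (simp add: a_def M_def)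
  next
    case False
    have "norm (a j n) = p n j / real j * norm w ^ j"
      using p0[of n j] by (simp add: a_def norm_mult norm_power norm_divide)
    also have "\<dots> \<le> zeta_even 1 / 1 * norm w ^ j"
      using False p_le[of j n] p0[of n j] by (intro mult_right_mono frac_le) auto
    finally show ?thesis by (simp add: M_def mult_ac)
  qed
  have Ms: "summable M" unfolding M_def using w
    by (intro summable_mult2 summable_geometric) auto
  have lim: "((\<lambda>n. a j n) \<longlongrightarrow> of_real (log_sine_coeff j) * w ^ j) sequentially" for j
  proof (cases "j = 0")
    case False
    have "(\<lambda>n. p n j) \<longlonglongrightarrow> zeta_even j" unfolding p_def zeta_even_def
      using False by (intro summable_LIMSEQ summable_zeta_even) auto
    thus ?thesis unfolding a_def log_sine_coeff_def by (intro tendsto_intros)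
  qed (simp add: a_def)
  have ev: "eventually (\<lambda>(k,n). norm (a k n) \<le> M k) (at_top \<times>\<^sub>F sequentially)"
    using bound by (intro always_eventually) auto
  note T = tannerys_theorem[OF lim ev Ms]
  show ?A using T by (auto dest: summable_norm_cancel)
  have eq: "(\<Prod>k=1..n. 1 + w / of_nat k ^ 2) = exp (suminf (\<lambda>j. a j n))" for n
  proof -
    have le: "norm (w / of_nat (Suc k) ^ 2) < 1" for k
    proof -
      have "norm (w / of_nat (Suc k) ^ 2) \<le> norm w / 1"
        unfolding norm_divide norm_power norm_of_nat by (intro divide_left_mono) auto
      thus ?thesis using w by simp
    qed
    have "(\<lambda>j. \<Sum>k<n. - ((- (w / of_nat (Suc k) ^ 2)) ^ j) / of_nat j) sums
            (\<Sum>k<n. ln (1 + w / of_nat (Suc k) ^ 2))"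
      by (intro sums_sum Ln_series' le)
    also have "(\<lambda>j. \<Sum>k<n. - ((- (w / of_nat (Suc k) ^ 2)) ^ j) / of_nat j) = (\<lambda>j. a j n)"
    proof
      fix j
      have "- ((- (w / of_nat (Suc k) ^ 2)) ^ j) / of_nat j =
              complex_of_real (- ((-1) ^ j) / real j) * w ^ j *
              complex_of_real (1 / real (Suc k) ^ (2 * j))" for k
        by (subst power_minus) (simp add: power_divide power_mult del: of_nat_Suc)
      thus "(\<Sum>k<n. - ((- (w / of_nat (Suc k) ^ 2)) ^ j) / of_nat j) = a j n"
        unfolding a_def p_def of_real_mult of_real_sum sum_distrib_left sum_distrib_right
        by (simp only: mult_ac)
    qed
    finally have "suminf (\<lambda>j. a j n) = (\<Sum>k<n. ln (1 + w / of_nat (Suc k) ^ 2))"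
      by (simp add: sums_iff)
    hence "exp (suminf (\<lambda>j. a j n)) = (\<Prod>k<n. exp (ln (1 + w / of_nat (Suc k) ^ 2)))"
      by (simp add: exp_sum)
    also have "\<dots> = (\<Prod>k<n. 1 + w / of_nat (Suc k) ^ 2)"
    proof (intro prod.cong refl exp_Ln)
      fix k show "1 + w / of_nat (Suc k) ^ 2 \<noteq> 0"
        using le[of k] by (metis add_eq_0_iff norm_minus_cancel norm_one order_less_irrefl)
    qed
    also have "\<dots> = (\<Prod>k=1..n. 1 + w / of_nat k ^ 2)"
      by (rule prod.reindex_bij_witness[of _ "\<lambda>k. k - 1" Suc]) auto
    finally show ?thesis ..
  qed
  show ?B unfolding eq using T by (intro tendsto_exp) auto
qed

text \<open>Since e^t - 1 = 2 e^(t/2) sinh(t/2), this is the sine product at an imaginary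
  argument.\<close>

lemma exp_minus_one_eq_exp_log_sine:
  fixes t :: complex
  assumes "norm t < 2 * pi"
  shows "exp t - 1 = t * exp (1 / 2 * t) *
           exp (\<Sum>j. of_real (log_sine_coeff j) * (t / of_real (2 * pi)) ^ (2 * j))"
proof -
  \<comment> \<open>Chosen so that pi z = i t/2 and \<open>z ^ 2 = - w\<close>; the sine factors 1 -
    z^2/k^2 become \<open>1 + w / of_nat k ^ 2\<close>.\<close>
  define z where "z = \<i> * t / of_real (2 * pi)"
  define w where "w = (t / of_real (2 * pi)) ^ 2"
  have "norm (t / of_real (2 * pi)) < 1" using assms by (simp add: norm_divide)
  hence nw: "norm w < 1" unfolding w_def norm_power by (simp add: power_less_one_iff)
  have zw: "z ^ 2 = - w" by (simp add: z_def w_def power_mult_distrib power_divide)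
  have "(\<lambda>n. of_real pi * z * (\<Prod>k=1..n. 1 + w / of_nat k ^ 2)) \<longlonglongrightarrow>
          of_real pi * z * exp (\<Sum>j. of_real (log_sine_coeff j) * w ^ j)"
    by (intro tendsto_intros product_tendsto_exp_log_sine nw)
  moreover have "(\<lambda>n. of_real pi * z * (\<Prod>k=1..n. 1 + w / of_nat k ^ 2)) \<longlonglongrightarrow> sin (of_real pi * z)"
    using sin_product_formula_complex[of z] by (simp add: zw)
  ultimately have "sin (of_real pi * z) =
       of_real pi * z * exp (\<Sum>j. of_real (log_sine_coeff j) * w ^ j)"
    using LIMSEQ_unique by blast
  moreover have piz: "of_real pi * z = \<i> * (t / 2)" by (simp add: z_def)
  moreover have "sin (\<i> * (t / 2)) = \<i> * (exp (t / 2) - exp (- (t / 2))) / 2"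
    by (simp add: sin_exp_eq field_simps)
  ultimately have "\<i> * (exp (t / 2) - exp (- (t / 2))) =
       \<i> * (t * exp (\<Sum>j. of_real (log_sine_coeff j) * w ^ j))"
    by (simp only: piz) simp
  hence "exp (t / 2) - exp (- (t / 2)) = t * exp (\<Sum>j. of_real (log_sine_coeff j) * w ^ j)"
    by (simp only: mult_cancel_left) simp
  hence "exp (t / 2) * (exp (t / 2) - exp (- (t / 2))) =
       exp (t / 2) * (t * exp (\<Sum>j. of_real (log_sine_coeff j) * w ^ j))" by simp
  moreover have "exp (t / 2) * (exp (t / 2) - exp (- (t / 2))) = exp t - 1"
    by (simp add: right_diff_distrib flip: exp_add)
  ultimately show ?thesis unfolding power_mult by (simp add: w_def mult_ac)
qed

text \<open>The logarithmic derivative of the product for e^t - 1 gives t e^t/(e^t - 1) = 1 + t/2 +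
  t L'(t). The left side is t + t/(e^t - 1), so comparing coefficients yields the formula.\<close>

theorem bernoulli_even_eq_zeta:
  assumes "j \<ge> 1"
  shows "bernoulli (2 * j) / fact (2 * j) = - ((-1) ^ j) * 2 * zeta_even j / (2 * pi) ^ (2 * j)"
proof -
  define l where "l n = (if even n then complex_of_real (log_sine_coeff (n div 2) / (2 * pi) ^ n) else 0)" for n
  define L where "L t = (\<Sum>j. complex_of_real (log_sine_coeff j) * (t / of_real (2 * pi)) ^ (2 * j))" for t
  define F where "F = Abs_fps l"
  define E where "E = (fps_exp 1 :: complex fps)"
  define W where "W = E oo F"
  define B where "B = Abs_fps (\<lambda>m. complex_of_real (bernoulli m / fact m))"
  have near: "eventually (\<lambda>t::complex. norm t < 2 * pi) (nhds 0)"
    using eventually_nhds_in_open[of "ball (0::complex) (2 * pi)" 0] by simp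
  have F0 [simp]: "fps_nth F 0 = 0" by (simp add: F_def l_def)
  have L: "L has_fps_expansion F"
  proof (rule has_fps_expansionI, use near in eventually_elim)
    fix t :: complex assume t: "norm t < 2 * pi"
    hence "norm (t / of_real (2 * pi)) < 1" by (simp add: norm_divide)
    hence "norm ((t / of_real (2 * pi)) ^ 2) < 1" unfolding norm_power by (simp add: power_less_one_iff)
    from summable_sums[OF product_tendsto_exp_log_sine(1)[OF this]]
    have "(\<lambda>j. of_real (log_sine_coeff j) * (t / of_real (2 * pi)) ^ (2 * j)) sums L t"
      unfolding L_def power_mult .
    also have "(\<lambda>j. of_real (log_sine_coeff j) * (t / of_real (2 * pi)) ^ (2 * j)) = (\<lambda>j. l (2 * j) * t ^ (2 * j))"
      by (simp add: l_def power_divide fun_eq_iff)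
    also have "\<dots> sums L t \<longleftrightarrow> (\<lambda>n. l n * t ^ n) sums L t"
      by (rule sums_mono_reindex) (auto simp: strict_mono_def l_def elim!: evenE)
    finally show "(\<lambda>n. fps_nth F n * t ^ n) sums L t" by (simp add: F_def)
  qed
  have "(\<lambda>t. exp (1 * t) - 1) has_fps_expansion E - 1"
    unfolding E_def by (intro fps_expansion_intros)
  moreover have "(\<lambda>t. exp (1 * t) - 1) has_fps_expansion fps_X * fps_exp (1 / 2) * W"
  proof -
    have "(\<lambda>t. t * exp (1 / 2 * t) * (exp \<circ> L) t) has_fps_expansion fps_X * fps_exp (1 / 2) * W"
      unfolding W_def E_def by (intro fps_expansion_intros L) simp
    also have "?this \<longleftrightarrow> ?thesis"
    proof (intro has_fps_expansion_cong refl, use near in eventually_elim)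
      fix t :: complex assume t: "norm t < 2 * pi"
      thus "t * exp (1 / 2 * t) * (exp \<circ> L) t = exp (1 * t) - 1"
        using exp_minus_one_eq_exp_log_sine[OF t] by (simp add: L_def)
    qed
    finally show ?thesis .
  qed
  \<comment> \<open>Uniqueness of power series expansions turns the analytic identity near 0 into
    one of formal power series.\<close>
  ultimately have EW: "E - 1 = fps_X * fps_exp (1 / 2) * W"
    by (rule fps_expansion_unique_complex)
  have dW: "fps_deriv W = W * fps_deriv F"
    unfolding W_def E_def by (simp add: fps_compose_deriv)
  have "fps_deriv (E - 1) = fps_deriv (fps_X * fps_exp (1 / 2) * W)"
    by (simp only: EW)
  hence "E = (1 + fps_const (1 / 2) * fps_X + fps_X * fps_deriv F) * (fps_exp (1 / 2) * W)"
    by (simp add: E_def dW algebra_simps)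
  hence XE: "fps_X * E = (1 + fps_const (1 / 2) * fps_X + fps_X * fps_deriv F) * (E - 1)"
    unfolding EW by (simp only: mult_ac)
  have BE: "B * (E - 1) = fps_X"
  proof (rule fps_ext)
    fix m
    have "fps_nth (B * (E - 1)) m =
          of_real (fps_nth (Abs_fps (\<lambda>m. bernoulli m / fact m) * (fps_exp 1 - 1)) m)"
      unfolding fps_mult_nth of_real_sum
      by (intro sum.cong refl) (simp add: B_def E_def)
    thus "fps_nth (B * (E - 1)) m = fps_nth fps_X m"
      unfolding bernoulli_egf by simp
  qed
  have "fps_nth (E - 1) 1 = 1" by (simp add: E_def)
  hence "E - 1 \<noteq> 0" by (metis fps_zero_nth zero_neq_one)
  moreover have "fps_X * E = (fps_X + B) * (E - 1)"
    by (simp only: distrib_right BE) (simp add: algebra_simps)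
  ultimately have "fps_X + B = 1 + fps_const (1 / 2) * fps_X + fps_X * fps_deriv F"
    using XE by simp
  hence "fps_nth (fps_X + B) (2 * j) = fps_nth (1 + fps_const (1 / 2) * fps_X + fps_X * fps_deriv F) (2 * j)"
    by simp
  \<comment> \<open>The constant and the linear terms do not reach the index \<open>2 * j\<close>,
    which is at least 2.\<close>
  hence "fps_nth B (2 * j) = of_nat (2 * j) * l (2 * j)"
    using assms by (simp add: F_def)
  also have "\<dots> = complex_of_real (- ((-1) ^ j) * 2 * zeta_even j / (2 * pi) ^ (2 * j))"
    using assms by (simp add: l_def log_sine_coeff_def field_simps)
  finally show ?thesis by (simp only: B_def fps_nth_Abs_fps of_real_eq_iff)
qed

section \<open>Strict log-convexity of the zeta sums over non-multiples of \<open>n\<close>\<close>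

text \<open>The sum of \<open>u m * (1 - t * x m) ^ 2\<close> is positive for every t, because
  \<open>1 - t * x m\<close> cannot vanish at both \<open>a\<close> and \<open>b\<close>. Its value
  at the minimising t gives the inequality.\<close>

lemma moment_cauchy_schwarz_strict:
  fixes u x :: "nat \<Rightarrow> real"
  assumes u: "\<And>m. u m \<ge> 0"
    and s: "summable u" "summable (\<lambda>m. u m * x m)" "summable (\<lambda>m. u m * x m ^ 2)"
    and pos: "u a > 0" "u b > 0" and ne: "x a \<noteq> x b"
  shows "(\<Sum>m. u m * x m) ^ 2 < (\<Sum>m. u m) * (\<Sum>m. u m * x m ^ 2)"
proof -
  define S0 S1 S2 where "S0 = (\<Sum>m. u m)" and "S1 = (\<Sum>m. u m * x m)"
    and "S2 = (\<Sum>m. u m * x m ^ 2)"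
  obtain c where c: "u c > 0" "x c \<noteq> 0" using pos ne by (cases "x a = 0") auto
  have S2: "S2 > 0" unfolding S2_def
    by (rule suminf_pos2[OF s(3), of c]) (use u c in auto)
  define t where "t = S1 / S2"
  have "(\<lambda>m. u m - 2 * t * (u m * x m) + t ^ 2 * (u m * x m ^ 2)) sums (S0 - 2 * t * S1 + t ^ 2 * S2)"
    unfolding S0_def S1_def S2_def
    by (intro sums_add sums_diff sums_mult summable_sums s)
  hence sq: "(\<lambda>m. u m * (1 - t * x m) ^ 2) sums (S0 - 2 * t * S1 + t ^ 2 * S2)"
    by (simp add: power2_eq_square algebra_simps)
  obtain e where e: "u e > 0" "1 - t * x e \<noteq> 0"
  proof (cases "1 - t * x a = 0")
    case True
    hence "t \<noteq> 0" by auto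
    hence "t * x a \<noteq> t * x b" using ne by simp
    hence "1 - t * x b \<noteq> 0" using True by linarith
    thus ?thesis using that pos by blast
  qed (use that pos in blast)
  have "(\<Sum>m. u m * (1 - t * x m) ^ 2) > 0"
    by (rule suminf_pos2[OF sums_summable[OF sq], of e]) (use u e in auto)
  hence "S0 - 2 * t * S1 + t ^ 2 * S2 > 0" using sq by (simp add: sums_iff)
  hence "S0 > S1 ^ 2 / S2" using S2 by (simp add: t_def power2_eq_square field_simps)
  hence "S1 ^ 2 < S0 * S2" using S2 by (simp add: field_simps)
  thus ?thesis by (simp add: S0_def S1_def S2_def)
qed

definition depleted_zeta :: "nat \<Rightarrow> nat \<Rightarrow> real" where
  "depleted_zeta n j = (1 - 1 / real n ^ (2 * j)) * zeta_even j"

text \<open>The multiples of \<open>n\<close> contribute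
  \<open>1 / real n ^ (2 * j) * zeta_even j\<close> to the full series and are subtracted from
  it.\<close>

lemma depleted_zeta_sums:
  assumes "n \<ge> 1" "j \<ge> 1"
  shows "(\<lambda>m. (if n dvd Suc m then 0 else 1) / real (Suc m) ^ (2 * j)) sums depleted_zeta n j"
proof -
  define g where "g m = (if n dvd Suc m then 1 / real (Suc m) ^ (2 * j) else 0)" for m
  \<comment> \<open>Index m stands for the integer m + 1, so \<open>h\<close> enumerates the indices
    of the multiples of \<open>n\<close>.\<close>
  define h where "h k = n * Suc k - 1" for k
  have Suc_h: "Suc (h k) = n * Suc k" for k using assms(1) by (simp add: h_def)
  have all: "(\<lambda>m. 1 / real (Suc m) ^ (2 * j)) sums zeta_even j"
    unfolding zeta_even_def by (intro summable_sums summable_zeta_even assms)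
  have "(\<lambda>k. 1 / real n ^ (2 * j) * (1 / real (Suc k) ^ (2 * j))) sums
          (1 / real n ^ (2 * j) * zeta_even j)"
    by (intro sums_mult all)
  also have "(\<lambda>k. 1 / real n ^ (2 * j) * (1 / real (Suc k) ^ (2 * j))) = (\<lambda>k. g (h k))"
    unfolding g_def Suc_h by (simp add: power_mult_distrib del: of_nat_Suc mult_Suc_right)
  also have "\<dots> sums (1 / real n ^ (2 * j) * zeta_even j) \<longleftrightarrow> g sums (1 / real n ^ (2 * j) * zeta_even j)"
  proof (rule sums_mono_reindex)
    have "Suc (h k) < Suc (h (Suc k))" for k unfolding Suc_h using assms(1) by simp
    thus "strict_mono h" by (simp add: strict_mono_Suc_iff)
  next
    fix m assume m: "m \<notin> range h"
    have "\<not> n dvd Suc m"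
    proof
      assume "n dvd Suc m"
      then obtain q where q: "Suc m = n * q" ..
      hence "m = h (q - 1)" by (cases q) (simp_all add: h_def flip: q)
      thus False using m by blast
    qed
    thus "g m = 0" by (simp add: g_def)
  qed
  finally have "(\<lambda>m. 1 / real (Suc m) ^ (2 * j) - g m) sums
                  (zeta_even j - 1 / real n ^ (2 * j) * zeta_even j)"
    by (intro sums_diff all)
  also have "(\<lambda>m. 1 / real (Suc m) ^ (2 * j) - g m) =
     (\<lambda>m. (if n dvd Suc m then 0 else 1) / real (Suc m) ^ (2 * j))"
    by (auto simp: g_def)
  finally show ?thesis by (simp add: depleted_zeta_def algebra_simps)
qed

lemma depleted_zeta_pos:
  assumes "n \<ge> 2" "j \<ge> 1" shows "depleted_zeta n j > 0"
proof -
  have *: "(\<lambda>m. (if n dvd Suc m then 0 else 1) / real (Suc m) ^ (2 * j)) sums depleted_zeta n j"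
    using assms by (intro depleted_zeta_sums) auto
  have "(\<Sum>m. (if n dvd Suc m then 0 else 1) / real (Suc m) ^ (2 * j)) > 0"
    by (rule suminf_pos2[OF sums_summable[OF *], of 0]) (use assms in auto)
  thus ?thesis using * by (simp add: sums_iff)
qed

text \<open>The three values are the moments of orders 0, 1 and 2 of the weights \<open>u\<close> at
  the points \<open>x m\<close>. Strictness comes from the indices 0 and \<open>n\<close>: the
  integers 1 and n + 1 are not multiples of \<open>n\<close>.\<close>

lemma depleted_zeta_log_convex:
  assumes "n \<ge> 2" "j \<ge> 1"
  shows "depleted_zeta n (Suc j) ^ 2 < depleted_zeta n j * depleted_zeta n (Suc (Suc j))"
proof -
  define u where "u m = (if n dvd Suc m then 0 else 1) / real (Suc m) ^ (2 * j)" for m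
  define x where "x m = 1 / real (Suc m) ^ 2" for m
  have s0: "u sums depleted_zeta n j"
    unfolding u_def using assms by (intro depleted_zeta_sums) auto
  have s1: "(\<lambda>m. u m * x m) sums depleted_zeta n (Suc j)"
    using depleted_zeta_sums[of n "Suc j"] assms
    by (simp add: u_def x_def power2_eq_square mult_ac del: of_nat_Suc)
  have s2: "(\<lambda>m. u m * x m ^ 2) sums depleted_zeta n (Suc (Suc j))"
    using depleted_zeta_sums[of n "Suc (Suc j)"] assms
    by (simp add: u_def x_def power2_eq_square mult_ac del: of_nat_Suc)
  have "\<not> n dvd Suc n"
    using assms dvd_diff_nat[of n "Suc n" n] by auto
  hence "u n > 0" by (simp add: u_def)
  moreover have "u 0 > 0" using assms by (simp add: u_def)
  moreover have "x n < x 0" unfolding x_def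
    using assms by (intro divide_strict_left_mono power_strict_mono) auto
  ultimately have "(\<Sum>m. u m * x m) ^ 2 < (\<Sum>m. u m) * (\<Sum>m. u m * x m ^ 2)"
    using s0 s1 s2
    by (intro moment_cauchy_schwarz_strict[where a = 0 and b = n])
       (auto simp: sums_iff, simp add: u_def)
  thus ?thesis using s0 s1 s2 by (simp add: sums_iff)
qed

text \<open>By log-convexity the ratios of consecutive values increase strictly, so a product grows
  when its two indices move apart with fixed sum.\<close>

lemma depleted_zeta_spread:
  assumes "n \<ge> 2" "i \<ge> 1" "i < j"
  shows "depleted_zeta n (Suc i) * depleted_zeta n j < depleted_zeta n i * depleted_zeta n (Suc j)"
proof -
  define r where "r j = depleted_zeta n (Suc j) / depleted_zeta n j" for j
  have p: "depleted_zeta n j > 0" if "j \<ge> 1" for j using depleted_zeta_pos that assms by blast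
  have "strict_mono (\<lambda>i. r (Suc i))"
    unfolding strict_mono_Suc_iff
  proof
    fix i
    show "r (Suc i) < r (Suc (Suc i))"
      using depleted_zeta_log_convex[OF assms(1), of "Suc i"] p[of "Suc i"] p[of "Suc (Suc i)"]
      by (simp add: r_def field_simps power2_eq_square)
  qed
  moreover obtain i' j' where "i = Suc i'" "j = Suc j'" "i' < j'"
    using assms(2,3) by (cases i; cases j) auto
  ultimately have "r i < r j" by (auto dest: strict_monoD)
  thus ?thesis using p[of i] p[of j] assms by (simp add: r_def field_simps)
qed

section \<open>The Enestroem-Kakeya theorem\<close>

text \<open>Multiplication by \<open>x - 1\<close> produces nonnegative coefficient differences. At
  a root, the triangle inequality and telescoping would bound \<open>b m * norm x ^ Suc m\<close> by
  \<open>b m * norm x ^ m\<close>.\<close>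

lemma enestroem_kakeya:
  fixes b :: "nat \<Rightarrow> real" and x :: complex
  assumes b0: "b 0 \<ge> 0" and bm: "b m > 0" and mono: "\<And>i. i < m \<Longrightarrow> b i \<le> b (Suc i)"
    and x: "norm x > 1"
  shows "(\<Sum>i\<le>m. of_real (b i) * x ^ i) \<noteq> 0"
proof
  assume 0: "(\<Sum>i\<le>m. of_real (b i) * x ^ i) = 0"
  have "(x - 1) * (\<Sum>i\<le>m. of_real (b i) * x ^ i) =
          of_real (b m) * x ^ Suc m - (of_real (b 0) + (\<Sum>i<m. of_real (b (Suc i) - b i) * x ^ Suc i))"
    by (induction m) (simp_all add: algebra_simps)
  hence eq: "of_real (b m) * x ^ Suc m =
               of_real (b 0) + (\<Sum>i<m. of_real (b (Suc i) - b i) * x ^ Suc i)"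
    using 0 by simp
  have "b m * norm x ^ Suc m = norm (of_real (b m) * x ^ Suc m)"
    using bm by (simp add: norm_mult norm_power)
  also have "\<dots> \<le> norm (complex_of_real (b 0)) + (\<Sum>i<m. norm (of_real (b (Suc i) - b i) * x ^ Suc i))"
    unfolding eq by (intro order.trans[OF norm_triangle_ineq] add_left_mono norm_sum)
  also have "\<dots> \<le> b 0 * norm x ^ m + (\<Sum>i<m. (b (Suc i) - b i) * norm x ^ m)"
  proof (intro add_mono sum_mono)
    show "norm (complex_of_real (b 0)) \<le> b 0 * norm x ^ m"
      using b0 x mult_left_mono[OF one_le_power[of "norm x" m] b0] by simp
  next
    fix i assume i: "i \<in> {..<m}"
    have "norm (of_real (b (Suc i) - b i) * x ^ Suc i) = (b (Suc i) - b i) * norm x ^ Suc i"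
      using mono[of i] i by (simp add: norm_mult norm_power del: of_real_diff)
    also have "\<dots> \<le> (b (Suc i) - b i) * norm x ^ m"
      using mono[of i] i x by (intro mult_left_mono power_increasing) auto
    finally show "norm (of_real (b (Suc i) - b i) * x ^ Suc i) \<le> (b (Suc i) - b i) * norm x ^ m" .
  qed
  also have "\<dots> = b m * norm x ^ m"
    by (simp add: sum_distrib_right[symmetric] sum_lessThan_telescope distrib_right[symmetric])
  also have "\<dots> < b m * norm x ^ Suc m"
    using bm x by (intro mult_strict_left_mono power_strict_increasing) auto
  finally show False by simp
qed

text \<open>The unit circle is excluded too, because the logarithmic derivative argument needs roots
  strictly inside the disc.\<close>

lemma enestroem_kakeya_strict:
  fixes b :: "nat \<Rightarrow> real" and x :: complex
  assumes b0: "b 0 > 0" and mono: "\<And>i. i < m \<Longrightarrow> b i < b (Suc i)" and x: "norm x \<ge> 1"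
  shows "(\<Sum>i\<le>m. of_real (b i) * x ^ i) \<noteq> 0"
proof -
  have pos: "b i > 0" if "i \<le> m" for i
    using that by (induction i) (use b0 mono in \<open>auto intro: less_trans[OF _ mono]\<close>)
  \<comment> \<open>Rescaling \<open>x\<close> by \<open>r < 1\<close> keeps the coefficients monotone and moves \<open>x\<close> off the unit circle.\<close>
  define r where "r = Max (insert (1 / 2) ((\<lambda>i. b i / b (Suc i)) ` {..<m}))"
  have r: "r > 0" "r < 1"
  proof -
    \<comment> \<open>The entry \<open>1 / 2\<close> makes \<open>r\<close> positive and keeps the
      set nonempty when \<open>m = 0\<close>.\<close>
    have "1 / 2 \<le> r" unfolding r_def by (intro Max_ge) auto
    thus "r > 0" by simp
    show "r < 1" unfolding r_def using mono pos by (subst Max_less_iff) auto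
  qed
  have le: "b i \<le> r * b (Suc i)" if "i < m" for i
  proof -
    have "b i / b (Suc i) \<le> r" unfolding r_def using that by (intro Max_ge) auto
    thus ?thesis using pos[of "Suc i"] that by (simp add: field_simps)
  qed
  have "(\<Sum>i\<le>m. of_real (b i * r ^ i) * (x / of_real r) ^ i) \<noteq> 0"
  proof (rule enestroem_kakeya)
    show "b i * r ^ i \<le> b (Suc i) * r ^ Suc i" if "i < m" for i
      using mult_right_mono[OF le[OF that], of "r ^ i"] r by (simp add: mult_ac)
    show "norm (x / of_real r) > 1" using r x by (simp add: norm_divide field_simps)
  qed (use r b0 pos[of m] in auto)
  also have "(\<Sum>i\<le>m. of_real (b i * r ^ i) * (x / of_real r) ^ i) = (\<Sum>i\<le>m. of_real (b i) * x ^ i)"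
    using r by (intro sum.cong refl) (simp add: power_divide)
  finally show ?thesis .
qed

section \<open>Polynomials with all roots in the unit disc\<close>

text \<open>\<open>1 / cnj w\<close> is the mirror image of \<open>w\<close> in the unit circle. The
  identity for the squared norms gives a weak inequality; the remaining division by
  \<open>norm w\<close> makes it strict even for \<open>norm \<alpha> = 1\<close>.\<close>

lemma norm_reflect_diff_less:
  fixes w \<alpha> :: complex
  assumes w: "norm w > 1" and \<alpha>: "norm \<alpha> \<le> 1"
  shows "norm (1 / cnj w - \<alpha>) < norm (w - \<alpha>)"
proof -
  have w0: "w \<noteq> 0" using w by auto
  have "norm (w - \<alpha>) ^ 2 - norm (1 - \<alpha> * cnj w) ^ 2 = (norm w ^ 2 - 1) * (1 - norm \<alpha> ^ 2)"
    unfolding cmod_power2 minus_complex.simps times_complex.simps one_complex.simps cnj.simps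
    by algebra
  also have "\<dots> \<ge> 0" using w \<alpha> by (intro mult_nonneg_nonneg) (auto simp: power_le_one)
  finally have le: "norm (1 - \<alpha> * cnj w) \<le> norm (w - \<alpha>)"
    by (simp add: power2_le_iff_abs_le)
  have "1 / cnj w - \<alpha> = (1 - \<alpha> * cnj w) / cnj w" using w0 by (simp add: diff_divide_distrib)
  hence "norm (1 / cnj w - \<alpha>) = norm (1 - \<alpha> * cnj w) / norm w" by (simp add: norm_divide)
  also have "\<dots> \<le> norm (w - \<alpha>) / norm w" using le by (intro divide_right_mono) auto
  also have "\<dots> < norm (w - \<alpha>)"
  proof -
    have "norm (w - \<alpha>) > 0" using w \<alpha> by auto
    thus ?thesis using w w0 by (simp add: divide_less_eq)
  qed
  finally show ?thesis .
qed

text \<open>\<open>p\<close> splits into linear factors, each of which shrinks under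
  reflection.\<close>

lemma norm_poly_reflect_less:
  fixes p :: "complex poly"
  assumes roots: "\<And>z. poly p z = 0 \<Longrightarrow> norm z \<le> 1" and deg: "degree p > 0" and w: "norm w > 1"
  shows "norm (poly p (1 / cnj w)) < norm (poly p w)"
proof -
  obtain root where root: "smult (lead_coeff p) (\<Prod>i<degree p. [:- root i, 1:]) = p"
    by (rule complex_poly_decompose')
  have ev: "poly p z = lead_coeff p * (\<Prod>i<degree p. z - root i)" for z
    by (subst root[symmetric]) (simp add: poly_prod)
  have le: "norm (root i) \<le> 1" if "i < degree p" for i
    by (rule roots) (use that in \<open>auto simp: ev\<close>)
  have "(\<Prod>i<degree p. norm (1 / cnj w - root i)) < (\<Prod>i<degree p. norm (w - root i))"
  proof (rule prod_mono_strict[of 0])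
    have less: "norm (1 / cnj w - root i) < norm (w - root i)" if "i < degree p" for i
      using that by (intro norm_reflect_diff_less w le)
    show "norm (1 / cnj w - root 0) < norm (w - root 0)" using deg by (rule less)
    fix i assume i: "i \<in> {..<degree p}"
    show "0 \<le> norm (1 / cnj w - root i) \<and> norm (1 / cnj w - root i) \<le> norm (w - root i)"
      using less[of i] i by simp
    show "0 < norm (w - root i)"
      using less[of i] i by (meson lessThan_iff norm_ge_zero order_le_less_trans)
  qed (use deg in auto)
  moreover have "norm (lead_coeff p) > 0" using deg by auto
  ultimately show ?thesis unfolding ev by (simp add: norm_mult prod_norm[symmetric])
qed

text \<open>The quotient is the sum of the \<open>w / (w - root i)\<close>, whose real parts have
  the sign of 1 - Re(w cnj(root i)) > 0.\<close>

lemma Re_logderiv_poly_pos: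
  fixes p :: "complex poly"
  assumes roots: "\<And>z. poly p z = 0 \<Longrightarrow> norm z < 1" and deg: "degree p > 0" and w: "norm w = 1"
  shows "Re (w * poly (pderiv p) w / poly p w) > 0"
proof -
  obtain root where root: "smult (lead_coeff p) (\<Prod>i<degree p. [:- root i, 1:]) = p"
    by (rule complex_poly_decompose')
  have ev: "poly p z = lead_coeff p * (\<Prod>i<degree p. z - root i)" for z
    by (subst root[symmetric]) (simp add: poly_prod)
  have less: "norm (root i) < 1" if "i < degree p" for i
    by (rule roots) (use that in \<open>auto simp: ev\<close>)
  have lc: "lead_coeff p \<noteq> 0" using deg by auto
  have *: "w * poly (pderiv (\<Prod>i<m. [:- root i, 1:])) w / poly (\<Prod>i<m. [:- root i, 1:]) w =
             (\<Sum>i<m. w / (w - root i))" if "m \<le> degree p" for m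
    using that
  proof (induction m)
    case (Suc m)
    have "w - root i \<noteq> 0" if "i \<le> m" for i
      using less[of i] Suc.prems that w by auto
    hence nz: "w - root m \<noteq> 0" "poly (\<Prod>i<m. [:- root i, 1:]) w \<noteq> 0"
      by (auto simp: poly_prod)
    define P where "P = (\<Prod>i<m. [:- root i, 1:])"
    have "w * poly (pderiv (P * [:- root m, 1:])) w / poly (P * [:- root m, 1:]) w =
            w * poly (pderiv P) w / poly P w + w / (w - root m)"
    proof -
      have "poly P w \<noteq> 0" using nz by (simp add: P_def)
      hence "w * (poly (pderiv P) w * (w - root m) + poly P w) / (poly P w * (w - root m)) =
               w * poly (pderiv P) w / poly P w + w / (w - root m)"
        using nz(1) by (simp add: distrib_left add_divide_distrib)
      moreover have "poly (pderiv (P * [:- root m, 1:])) w = poly (pderiv P) w * (w - root m) + poly P w"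
        unfolding pderiv_mult by (simp add: pderiv_pCons algebra_simps)
      moreover have "poly (P * [:- root m, 1:]) w = poly P w * (w - root m)"
        by (simp add: algebra_simps)
      ultimately show ?thesis by simp
    qed
    thus ?case using Suc.IH Suc.prems by (simp only: P_def prod.lessThan_Suc sum.lessThan_Suc Suc_leD)
  qed simp
  have "w * poly (pderiv p) w / poly p w = (\<Sum>i<degree p. w / (w - root i))"
  proof -
    define P where "P = (\<Prod>i<degree p. [:- root i, 1:])"
    have p: "p = smult (lead_coeff p) P" unfolding P_def by (rule root[symmetric])
    have "poly p w = lead_coeff p * poly P w" "poly (pderiv p) w = lead_coeff p * poly (pderiv P) w"
      by (subst p, simp add: pderiv_smult)+
    thus ?thesis using *[of "degree p"] lc by (simp flip: P_def)
  qed
  moreover have "Re (w / (w - root i)) > 0" if "i < degree p" for i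
  proof -
    have "Re (w * cnj (root i)) \<le> norm (w * cnj (root i))" by (rule complex_Re_le_cmod)
    also have "\<dots> < 1" using less[OF that] w by (simp add: norm_mult)
    finally have "Re (w * cnj (w - root i)) > 0"
      using complex_norm_square[of w] w by (simp only: complex_cnj_diff right_diff_distrib minus_complex.simps) simp
    moreover have "w - root i \<noteq> 0" using less[OF that] w by auto
    ultimately show ?thesis by (simp add: Re_complex_div_gt_0)
  qed
  ultimately show ?thesis using deg by (auto simp: lessThan_empty_iff intro!: sum_pos)
qed

section \<open>Palindromic polynomials in even powers\<close>

text \<open>A(w) + A(1/w) is symmetric under inversion, so excluding roots with |w| > 1 suffices for
  the location. A double root on the circle would make w A'(w)/A(w) purely imaginary.\<close>

lemma palindromic_poly_roots:
  fixes c :: "nat \<Rightarrow> real" and d :: nat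
  defines "Q \<equiv> (\<Sum>i\<le>d. monom (complex_of_real (c i)) (2 * i))"
  assumes sym: "\<And>i. i \<le> d \<Longrightarrow> c (d - i) = c i"
    and pos: "\<And>i. i \<le> d \<Longrightarrow> c i > 0"
    and mono: "\<And>i. i < d \<Longrightarrow> d \<le> 2 * i \<Longrightarrow> c i < c (Suc i)"
    and root: "poly Q w = 0"
  shows "norm w = 1" and "poly (pderiv Q) w \<noteq> 0"
proof -
  \<comment> \<open>A middle coefficient, present for even \<open>d\<close>, is shared equally between \<open>A(w)\<close> and \<open>A(1/w)\<close>.\<close>
  define a where "a i = (if 2 * i > d then c i else if 2 * i = d then c i / 2 else 0)" for i
  \<comment> \<open>Truncated subtraction sends the exponents with \<open>2 * i < d\<close> to 0,
    but there \<open>a i\<close> vanishes.\<close>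
  define A where "A = (\<Sum>i\<le>d. monom (complex_of_real (a i)) (2 * i - d))"
  have a_sym: "a i + a (d - i) = c i" if "i \<le> d" for i
  proof -
    consider "2 * i > d" | "2 * i = d" | "2 * i < d" by linarith
    thus ?thesis using sym[OF that] that by cases (auto simp: a_def)
  qed
  have Qz: "poly Q z = (\<Sum>i\<le>d. of_real (c i) * z ^ (2 * i))" for z
    by (simp add: Q_def poly_sum poly_monom)
  have Q'z: "z * poly (pderiv Q) z = (\<Sum>i\<le>d. of_nat (2 * i) * of_real (c i) * z ^ (2 * i))" for z
    unfolding Q_def higher_pderiv_sum[of 1, simplified] poly_sum sum_distrib_left
  proof (intro sum.cong refl)
    fix i show "z * poly (pderiv (monom (of_real (c i)) (2 * i))) z = of_nat (2 * i) * of_real (c i) * z ^ (2 * i)"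
      by (cases i) (simp_all add: pderiv_monom poly_monom)
  qed
  have Az: "poly A z = (\<Sum>i\<le>d. of_real (a i) * z ^ (2 * i - d))" for z
    by (simp add: A_def poly_sum poly_monom)
  have A'z: "z * poly (pderiv A) z = (\<Sum>i\<le>d. of_nat (2 * i - d) * of_real (a i) * z ^ (2 * i - d))" for z
    unfolding A_def higher_pderiv_sum[of 1, simplified] poly_sum sum_distrib_left
  proof (intro sum.cong refl)
    fix i show "z * poly (pderiv (monom (of_real (a i)) (2 * i - d))) z = of_nat (2 * i - d) * of_real (a i) * z ^ (2 * i - d)"
      by (cases "2 * i - d") (simp_all add: pderiv_monom poly_monom)
  qed
  \<comment> \<open>The weight \<open>g\<close> is 1 for \<open>A\<close> itself and
    \<open>2 * i - d\<close> for its derivative.\<close>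
  have shift: "z ^ d * (\<Sum>i\<le>d. g i * of_real (a i) * z ^ (2 * i - d)) = (\<Sum>i\<le>d. g i * of_real (a i) * z ^ (2 * i))"
    for z :: complex and g
    unfolding sum_distrib_left
  proof (intro sum.cong refl)
    fix i show "z ^ d * (g i * of_real (a i) * z ^ (2 * i - d)) = g i * of_real (a i) * z ^ (2 * i)"
    proof (cases "d \<le> 2 * i")
      case True
      hence "z ^ (2 * i) = z ^ d * z ^ (2 * i - d)" by (simp flip: power_add)
      thus ?thesis by simp
    qed (simp add: a_def)
  qed
  have shift': "z ^ d * (\<Sum>i\<le>d. g i * of_real (a i) * (1 / z) ^ (2 * i - d)) =
      (\<Sum>i\<le>d. g (d - i) * of_real (a (d - i)) * z ^ (2 * i))" if z: "z \<noteq> 0" for z :: complex and g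
  proof -
    have "z ^ d * (\<Sum>i\<le>d. g i * of_real (a i) * (1 / z) ^ (2 * i - d)) =
          (\<Sum>i\<le>d. g i * of_real (a i) * z ^ (2 * (d - i)))"
      unfolding sum_distrib_left
    proof (intro sum.cong refl)
      fix i assume i: "i \<in> {..d}"
      show "z ^ d * (g i * of_real (a i) * (1 / z) ^ (2 * i - d)) = g i * of_real (a i) * z ^ (2 * (d - i))"
      proof (cases "d \<le> 2 * i")
        case True
        have "2 * (d - i) + (2 * i - d) = d" using True i by auto
        hence "z ^ d = z ^ (2 * (d - i)) * z ^ (2 * i - d)" by (metis power_add)
        thus ?thesis using z by (simp add: power_divide)
      qed (simp add: a_def)
    qed
    also have "\<dots> = (\<Sum>i\<le>d. g (d - i) * of_real (a (d - i)) * z ^ (2 * i))"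
      by (rule sum.reindex_bij_witness[of _ "\<lambda>i. d - i" "\<lambda>i. d - i"]) auto
    finally show ?thesis .
  qed
  have QA: "poly Q z = z ^ d * (poly A z + poly A (1 / z))" if "z \<noteq> 0" for z
  proof -
    have "z ^ d * (poly A z + poly A (1 / z)) =
        (\<Sum>i\<le>d. of_real (a i) * z ^ (2 * i)) + (\<Sum>i\<le>d. of_real (a (d - i)) * z ^ (2 * i))"
      unfolding distrib_left Az using shift[of z "\<lambda>_. 1"] shift'[OF that, of "\<lambda>_. 1"] by simp
    also have "\<dots> = poly Q z"
      unfolding Qz sum.distrib[symmetric]
      by (intro sum.cong refl) (simp add: distrib_right flip: a_sym)
    finally show ?thesis ..
  qed
  \<comment> \<open>This is z d/dz applied to \<open>QA\<close>, checked on coefficients; the term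
    \<open>of_nat d * poly Q z\<close> comes from the factor \<open>z ^ d\<close>.\<close>
  have QA': "z * poly (pderiv Q) z - of_nat d * poly Q z =
      z ^ d * (z * poly (pderiv A) z - 1 / z * poly (pderiv A) (1 / z))" if "z \<noteq> 0" for z
  proof -
    have "z ^ d * (z * poly (pderiv A) z - 1 / z * poly (pderiv A) (1 / z)) =
       (\<Sum>i\<le>d. (of_nat (2 * i - d) * of_real (a i) - of_nat (2 * (d - i) - d) * of_real (a (d - i))) * z ^ (2 * i))"
      unfolding right_diff_distrib A'z[of z] A'z[of "1 / z"] shift shift'[OF that]
      by (simp only: sum_subtractf left_diff_distrib)
    also have "\<dots> = (\<Sum>i\<le>d. (of_nat (2 * i) - of_nat d) * of_real (c i) * z ^ (2 * i))"
    proof (intro sum.cong refl)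
      fix i assume i: "i \<in> {..d}"
      have 1: "of_nat (2 * i - d) * complex_of_real (a i) = (of_nat (2 * i) - of_nat d) * of_real (a i)"
      proof (cases "d \<le> 2 * i")
        case True
        thus ?thesis by (simp only: of_nat_diff)
      qed (simp add: a_def)
      have 2: "of_nat (2 * (d - i) - d) * complex_of_real (a (d - i)) = (of_nat d - of_nat (2 * i)) * of_real (a (d - i))"
      proof (cases "2 * i \<le> d")
        case True
        hence "2 * (d - i) - d = d - 2 * i" by simp
        thus ?thesis using True by (simp only: of_nat_diff)
      next
        case False
        hence "2 * (d - i) < d" using i by auto
        thus ?thesis by (simp add: a_def)
      qed
      have 3: "complex_of_real (c i) = of_real (a i) + of_real (a (d - i))"
        using i a_sym[of i] by (simp flip: of_real_add)
      have "((m - e) * x - (e - m) * y) * q = (m - e) * (x + y) * q" for m e x y q :: complex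
        by (simp add: algebra_simps)
      thus "(of_nat (2 * i - d) * of_real (a i) - of_nat (2 * (d - i) - d) * of_real (a (d - i))) * z ^ (2 * i) =
          (of_nat (2 * i) - of_nat d) * of_real (c i) * z ^ (2 * i)"
        by (simp only: 1 2 3)
    qed
    also have "\<dots> = z * poly (pderiv Q) z - of_nat d * poly Q z"
      unfolding Q'z Qz sum_distrib_left sum_subtractf[symmetric]
      by (intro sum.cong refl) (simp only: left_diff_distrib mult.assoc)
    finally show ?thesis ..
  qed
  have cnjA: "poly A (cnj z) = cnj (poly A z)" for z by (simp add: Az)
  have cnjA': "cnj z * poly (pderiv A) (cnj z) = cnj (z * poly (pderiv A) z)" for z
    unfolding A'z by simp
  have A_roots: "norm z < 1" if "poly A z = 0" for z
  proof (rule ccontr)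
    assume "\<not> norm z < 1"
    hence z: "norm z \<ge> 1" by simp
    hence z0: "z \<noteq> 0" by auto
    \<comment> \<open>The first index with nonzero \<open>a\<close>. Splitting off
      \<open>z ^ (2 * s - d)\<close> leaves a polynomial in \<open>z ^ 2\<close> whose coefficients
      are positive and strictly increasing, also when the first one is halved.\<close>
    define s where "s = (d + 1) div 2"
    have s: "s \<le> d" "d \<le> 2 * s" "\<And>i. i < s \<Longrightarrow> a i = 0"
      by (auto simp: s_def a_def)
    have "poly A z = (\<Sum>i=s..d. of_real (a i) * z ^ (2 * i - d))"
      unfolding Az using s by (intro sum.mono_neutral_right) auto
    also have "\<dots> = (\<Sum>i\<le>d-s. of_real (a (s + i)) * z ^ (2 * (s + i) - d))"
      by (rule sum.reindex_bij_witness[of _ "\<lambda>i. s + i" "\<lambda>i. i - s"]) (use s in auto)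
    also have "\<dots> = z ^ (2 * s - d) * (\<Sum>i\<le>d-s. of_real (a (s + i)) * (z ^ 2) ^ i)"
      unfolding sum_distrib_left
    proof (intro sum.cong refl)
      fix i
      have "2 * (s + i) - d = (2 * s - d) + 2 * i" using s by simp
      thus "of_real (a (s + i)) * z ^ (2 * (s + i) - d) = z ^ (2 * s - d) * (of_real (a (s + i)) * (z ^ 2) ^ i)"
        by (simp add: power_add power_mult)
    qed
    also have "\<dots> \<noteq> 0"
    proof -
      have "(\<Sum>i\<le>d-s. of_real (a (s + i)) * (z ^ 2) ^ i) \<noteq> 0"
      proof (rule enestroem_kakeya_strict)
        show "a (s + 0) > 0" using s pos[of s] by (auto simp: a_def)
        show "norm (z ^ 2) \<ge> 1" using z by (simp add: norm_power)
        fix i assume "i < d - s"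
        hence "c (s + i) < c (Suc (s + i))" "c (s + i) > 0" "d \<le> 2 * (s + i)"
          using s mono[of "s + i"] pos[of "s + i"] by auto
        thus "a (s + i) < a (s + Suc i)" by (auto simp: a_def)
      qed
      thus ?thesis using z0 by simp
    qed
    finally show False using that by simp
  qed
  have w0: "w \<noteq> 0"
  proof
    assume "w = 0"
    hence "poly Q w = of_real (c 0)" by (simp add: Qz power_0_left if_distrib cong: if_cong)
    thus False using root pos[of 0] by simp
  qed
  have d: "d > 0"
  proof (rule ccontr)
    assume "\<not> d > 0"
    hence "poly Q w = of_real (c 0)" by (simp add: Qz)
    thus False using root pos[of 0] by simp
  qed
  have "coeff A d = of_real (a d)"
  proof -
    have "coeff A d = (\<Sum>i\<le>d. if i = d then of_real (a i) else 0)"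
      unfolding A_def coeff_sum using d by (intro sum.cong refl) auto
    thus ?thesis by simp
  qed
  hence "degree A \<ge> d" using d pos[of d] by (intro le_degree) (simp add: a_def)
  hence deg: "degree A > 0" using d by simp
  have A0: "poly A z + poly A (1 / z) \<noteq> 0" if "norm z > 1" for z
  proof
    assume "poly A z + poly A (1 / z) = 0"
    hence "norm (poly A z) = norm (poly A (1 / z))" by (simp add: add_eq_0_iff)
    \<comment> \<open>The coefficients of \<open>A\<close> are real, so conjugating the argument
      preserves the norm.\<close>
    also have "\<dots> = norm (poly A (1 / cnj z))"
      using cnjA[of "1 / z"] by simp
    also have "\<dots> < norm (poly A z)"
      using A_roots deg that by (intro norm_poly_reflect_less) (auto intro: less_imp_le)
    finally show False by simp
  qed
  have sum0: "poly A w + poly A (1 / w) = 0" using QA[OF w0] root w0 by simp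
  show nw: "norm w = 1"
  proof (rule ccontr)
    assume "norm w \<noteq> 1"
    then consider "norm w > 1" | "norm (1 / w) > 1" using w0 by (force simp: norm_divide)
    thus False
    proof cases
      case 1
      thus False using A0 sum0 by blast
    next
      case 2
      thus False using A0[of "1 / w"] sum0 by (simp add: add.commute)
    qed
  qed
  have inv: "1 / w = cnj w"
    using nw w0 complex_norm_square[of w] by (simp add: field_simps)
  define V where "V = w * poly (pderiv A) w"
  show "poly (pderiv Q) w \<noteq> 0"
  proof
    assume "poly (pderiv Q) w = 0"
    \<comment> \<open>On the circle \<open>1 / w\<close> is \<open>cnj w\<close>, so
      \<open>QA'\<close> equates \<open>V\<close> with its conjugate; in the same way
      \<open>sum0\<close> makes \<open>poly A w\<close> purely imaginary.\<close>
    hence "V = cnj V" using QA'[OF w0] w0 root cnjA'[of w] by (simp add: V_def inv)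
    hence "Im V = 0" by (metis Reals_cnj_iff complex_is_Real_iff)
    moreover have "Re (poly A w) = 0" using sum0 by (simp add: inv cnjA complex_eq_iff)
    ultimately have "Re (V / poly A w) = 0" by (simp add: Re_divide)
    moreover have "Re (V / poly A w) > 0" unfolding V_def
      by (rule Re_logderiv_poly_pos[OF A_roots deg nw])
    ultimately show False by simp
  qed
qed

section \<open>Transfer to the Ramanujan-type polynomial\<close>

theorem theorem1p2:
  fixes k n :: nat
  assumes "k \<ge> 1" and "n \<ge> 2"
  shows "{z \<in> \<real>. poly (ramanujan_poly k n) z = 0} = {0} \<and>
         order 0 (ramanujan_poly k n) = 2 \<and>
         (\<forall>z. z \<notin> \<real> \<and> poly (ramanujan_poly k n) z = 0 \<longrightarrow>
              order z (ramanujan_poly k n) = 1 \<and> cmod z = 1 / real n)"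
proof -
  define d where "d = k - 1"
  \<comment> \<open>Here i = k - j, so that \<open>k - i\<close> is j and \<open>Suc i\<close> is k
    + 1 - j, the halved indices of the paired Bernoulli numbers.\<close>
  define c where "c i = depleted_zeta n (k - i) * depleted_zeta n (Suc i)" for i
  \<comment> \<open>The common factor left by Euler's formula: the signs multiply to (-1)^(k+1), the
    two factors 2 to 4, and the exponents of n/(2 pi) add up to 2k + 2.\<close>
  define K where "K = (-1) ^ Suc k * 4 * (real n / (2 * pi)) ^ (2 * k + 2)"
  define Q where "Q = (\<Sum>i\<le>d. monom (complex_of_real (c i)) (2 * i))"
  define S where "S = pcompose Q [:0, of_nat n:]"
  have n0: "n > 0" using assms by simp
  have K0: "K \<noteq> 0" using n0 by (simp add: K_def)
  have Q_eval: "poly Q w = (\<Sum>i\<le>d. of_real (c i) * w ^ (2 * i))" for w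
    by (simp add: Q_def poly_sum poly_monom)
  have pos: "c i > 0" if "i \<le> d" for i
    unfolding c_def using assms that by (intro mult_pos_pos depleted_zeta_pos) (auto simp: d_def)
  have sym: "c (d - i) = c i" if "i \<le> d" for i
  proof -
    have "k - (d - i) = Suc i" "Suc (d - i) = k - i" using that assms by (auto simp: d_def)
    thus ?thesis by (simp add: c_def mult.commute)
  qed
  have mono: "c i < c (Suc i)" if "i < d" "d \<le> 2 * i" for i
  proof -
    have "Suc (k - Suc i) = k - i" using that by (auto simp: d_def)
    \<comment> \<open>In the upper half \<open>k - Suc i\<close> lies below \<open>Suc i\<close>, as
      \<open>depleted_zeta_spread\<close> requires.\<close>
    moreover have "k - Suc i \<ge> 1" "k - Suc i < Suc i" using that by (auto simp: d_def)
    ultimately show ?thesis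
      using depleted_zeta_spread[OF assms(2), of "k - Suc i" "Suc i"] by (simp add: c_def)
  qed
  have coeff_eq: "(real n ^ (2 * j) - 1) * (real n ^ (2 * k + 2 - 2 * j) - 1) *
       (bernoulli (2 * j) * bernoulli (2 * k + 2 - 2 * j) / (fact (2 * j) * fact (2 * k + 2 - 2 * j)))
      = K * c (k - j)" if j: "j \<in> {1..k}" for j
  proof -
    define l where "l = Suc k - j"
    have l: "2 * k + 2 - 2 * j = 2 * l" "l \<ge> 1" "Suc (k - j) = l" "k - (k - j) = j" "2 * k + 2 = 2 * j + 2 * l"
      and jl: "j + l = Suc k"
      using j by (auto simp: l_def)
    \<comment> \<open>Writing n^(2i) - 1 = n^(2i) (1 - n^(-2i)) turns the zeta value into its
      depleted form.\<close>
    have *: "(real n ^ (2 * i) - 1) * (bernoulli (2 * i) / fact (2 * i)) =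
            - ((-1) ^ i) * 2 * (real n / (2 * pi)) ^ (2 * i) * depleted_zeta n i" if "i \<ge> 1" for i
      unfolding bernoulli_even_eq_zeta[OF that] depleted_zeta_def using n0
      by (simp add: power_divide field_simps)
    have "(real n ^ (2 * j) - 1) * (real n ^ (2 * l) - 1) *
            (bernoulli (2 * j) * bernoulli (2 * l) / (fact (2 * j) * fact (2 * l))) =
          ((real n ^ (2 * j) - 1) * (bernoulli (2 * j) / fact (2 * j))) *
          ((real n ^ (2 * l) - 1) * (bernoulli (2 * l) / fact (2 * l)))"
      by simp
    also have "\<dots> = ((-1) ^ j * (-1) ^ l) * 4 * ((real n / (2 * pi)) ^ (2 * j) * (real n / (2 * pi)) ^ (2 * l)) *
          (depleted_zeta n j * depleted_zeta n l)"
      using j l(2) by (subst (1 2) *) auto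
    also have "\<dots> = K * c (k - j)"
      unfolding power_add[symmetric] jl l(5)[symmetric] by (simp add: K_def c_def l(3,4))
    finally show ?thesis unfolding l(1) .
  qed
  \<comment> \<open>All exponents are at least 2, so (n z)^2 splits off; the cofactor
    \<open>S\<close> is \<open>Q\<close> at n z.\<close>
  have R: "ramanujan_poly k n = smult (of_real K * of_nat n ^ 2) ([:0, 1:] ^ 2 * S)"
  proof (rule iffD1[OF poly_eq_poly_eq_iff], rule ext)
    fix z
    have "poly (ramanujan_poly k n) z =
            (\<Sum>j=1..k. of_real (K * c (k - j)) * (of_nat n * z) ^ (2 * k + 2 - 2 * j))"
      unfolding ramanujan_poly_def poly_sum
    proof (intro sum.cong refl)
      fix j assume "j \<in> {1..k}"
      from coeff_eq[OF this] show
        "poly (smult (of_real ((real n ^ (2 * j) - 1) * (real n ^ (2 * k + 2 - 2 * j) - 1) *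
               (bernoulli (2 * j) * bernoulli (2 * k + 2 - 2 * j) /
                 (fact (2 * j) * fact (2 * k + 2 - 2 * j)))))
            ([:0, of_nat n:] ^ (2 * k + 2 - 2 * j))) z =
          of_real (K * c (k - j)) * (of_nat n * z) ^ (2 * k + 2 - 2 * j)"
        by (simp only: poly_smult poly_power poly_pCons poly_0) (simp add: mult.commute)
    qed
    also have "\<dots> = (\<Sum>j=1..k. of_real (K * c (k - j)) * (of_nat n * z) ^ (2 * (k - j) + 2))"
    proof (intro sum.cong refl)
      fix j assume "j \<in> {1..k}"
      hence "2 * k + 2 - 2 * j = 2 * (k - j) + 2" by auto
      thus "of_real (K * c (k - j)) * (of_nat n * z) ^ (2 * k + 2 - 2 * j) =
            of_real (K * c (k - j)) * (of_nat n * z) ^ (2 * (k - j) + 2)" by simp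
    qed
    also have "\<dots> = (\<Sum>i\<le>d. of_real (K * c i) * (of_nat n * z) ^ (2 * i + 2))"
      by (rule sum.reindex_bij_witness[of _ "\<lambda>i. k - i" "\<lambda>j. k - j"])
         (use assms in \<open>auto simp: d_def\<close>)
    also have "\<dots> = of_real K * (of_nat n * z) ^ 2 * poly Q (of_nat n * z)"
      unfolding Q_eval sum_distrib_left by (intro sum.cong refl) (simp add: power_add power2_eq_square)
    also have "\<dots> = poly (smult (of_real K * of_nat n ^ 2) ([:0, 1:] ^ 2 * S)) z"
      by (simp add: S_def poly_pcompose power_mult_distrib mult_ac)
    finally show "poly (ramanujan_poly k n) z =
        poly (smult (of_real K * of_nat n ^ 2) ([:0, 1:] ^ 2 * S)) z" .
  qed
  have S0: "poly S 0 \<noteq> 0"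
  proof -
    have "poly Q 0 = (\<Sum>i\<le>d. if i = 0 then of_real (c i) else 0)"
      unfolding Q_eval by (intro sum.cong refl) auto
    thus ?thesis using pos[of 0] by (simp add: S_def poly_pcompose)
  qed
  hence S_nz: "S \<noteq> 0" by auto
  have const_nz: "of_real K * of_nat n ^ 2 \<noteq> (0 :: complex)" using K0 n0 by simp
  have root_iff: "poly (ramanujan_poly k n) z = 0 \<longleftrightarrow> z = 0 \<or> poly S z = 0" for z
    unfolding R using const_nz by simp
  have ord: "order z (ramanujan_poly k n) = order z ([:0, 1:] ^ 2) + order z S" for z
    unfolding R using const_nz S_nz by (subst order_smult, simp, subst order_mult) auto
  have S_root: "norm z = 1 / real n" "order z S = 1" if "poly S z = 0" for z
  proof -
    have Q0: "poly Q (of_nat n * z) = 0" using that by (simp add: S_def poly_pcompose mult.commute)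
    have "norm (of_nat n * z) = 1"
      by (rule palindromic_poly_roots(1)[OF sym pos mono Q0[unfolded Q_def]])
    thus "norm z = 1 / real n" using n0 by (simp add: norm_mult field_simps)
    have "poly (pderiv Q) (of_nat n * z) \<noteq> 0"
      unfolding Q_def by (rule palindromic_poly_roots(2)[OF sym pos mono Q0[unfolded Q_def]])
    hence "poly (pderiv S) z \<noteq> 0"
      using n0 by (simp add: S_def pderiv_pcompose poly_pcompose pderiv_pCons mult.commute)
    thus "order z S = 1"
      using order_pderiv[OF S_nz that] by (simp add: order_0I)
  qed
  have S_real: "poly S z \<noteq> 0" if "z \<in> \<real>" for z
  proof -
    obtain x where x: "of_nat n * z = complex_of_real x" using \<open>z \<in> \<real>\<close>
      by (metis Reals_cases of_real_mult of_real_of_nat_eq)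
    \<comment> \<open>Only even powers with positive coefficients occur, and the constant term is
      positive.\<close>
    have "(\<Sum>i\<le>d. c i * x ^ (2 * i)) > 0"
    proof (rule sum_pos2)
      show "0 < c 0 * x ^ (2 * 0)" using pos[of 0] by simp
      show "0 \<le> c i * x ^ (2 * i)" if "i \<in> {..d}" for i
        using pos[of i] that by (simp add: power_mult)
    qed auto
    moreover have "poly S z = of_real (\<Sum>i\<le>d. c i * x ^ (2 * i))"
      by (simp add: S_def poly_pcompose mult.commute[of z] x Q_eval)
    ultimately show ?thesis by (simp only: of_real_eq_0_iff)
  qed
  have "{z \<in> \<real>. poly (ramanujan_poly k n) z = 0} = {0}"
    using S_real by (auto simp: root_iff)
  moreover have "order 0 (ramanujan_poly k n) = 2"
    using order_power_n_n[of "0::complex" 2] order_0I[OF S0] by (simp add: ord)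
  moreover have "order z (ramanujan_poly k n) = 1 \<and> cmod z = 1 / real n"
    if "z \<notin> \<real>" "poly (ramanujan_poly k n) z = 0" for z
  proof -
    have z: "z \<noteq> 0" using that by auto
    hence "order z ([:0, 1:] ^ 2) = 0" by (intro order_0I) simp
    thus ?thesis using S_root[of z] that z by (simp add: root_iff ord)
  qed
  ultimately show ?thesis by blast
qed

end
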